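(* Let $\kappa$ be an uncountable cardinal. Then there is a $\kappa^+$-Borel function $f$ from the space $\mathsf{GRAPHS}_\kappa$ of graphs on $\kappa$ to $\mathcal{MS}_\kappa$ with the following properties: (i) for all graphs $G,H$ on $\kappa$, $G\cong H$ if and only if $M_{f(G)}$ and $M_{f(H)}$ are isometric; (ii) for every graph $G$, the space $M_{f(G)}$ is discrete. In other words, isomorphism of graphs on $\kappa$ is $\kappa^+$-Borel reducible to isometry between discrete complete metric spaces of density character $\kappa$.
   Context: Topology and Borel sets on ${}^\kappa2$: - The generalized Cantor space ${}^\kappa 2$ carries the bounded topology, generated by the sets $N_s=\{x\in{}^\kappa 2\mid s\subseteq x\}$ for $s\in{}^{<\kappa}2$. - A subset is $\kappa^+$-Borel if it belongs to the smallest family containing the open sets and closed under complements and unions of at most $\kappa$ many sets. - A function between subspaces of ${}^\kappa2$ is $\kappa^+$-Borel if the preimage of every relatively $\kappa^+$-Borel set is relatively $\kappa^+$-Borel. - Spaces of the form ${}^{\kappa\times\kappa}2$ and ${}^{\kappa\times\kappa\times\mathbb{Q}_{>0}}2$ are identified with (closed subspaces of) ${}^\kappa2$ via fixed bijections $\kappa\times\kappa\to\kappa$, $\kappa\times\kappa\times\mathbb{Q}_{>0}\to\kappa\times\kappa\times\kappa\to\kappa$. Graphs on $\kappa$: - A graph on $\kappa$ is coded by the characteristic function in ${}^{\kappa\times\kappa}2$ of a symmetric irreflexive relation on $\kappa$. - $\mathsf{GRAPHS}_\kappa$ is the set of such codes. - $\cong$ denotes graph isomorphism. The space $\mathcal{MS}_\kappa$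 of codes for complete metric spaces of density character $\kappa$ is the set of $c\in{}^{\kappa\times\kappa\times\mathbb{Q}_{>0}}2$ satisfying all of the following: - $q\le q'$ implies $c(\alpha,\beta,q)\le c(\alpha,\beta,q')$; - for all $\alpha,\beta$ there is $q$ with $c(\alpha,\beta,q)=1$; - $c(\alpha,\alpha,q)=1$ for all $\alpha,q$; - for all $\alpha<\beta$ there is $q$ with $c(\alpha,\beta,q)=0$; - $c(\alpha,\beta,q)=c(\beta,\alpha,q)$ for all $\alpha,\beta,q$; - $c(\alpha,\beta,q)=c(\beta,\gamma,q')=1$ implies $c(\alpha,\gamma,q+q')=1$; - for every $\alpha<\kappa$ there are $\beta<\kappa$ and $q$ such that $c(\gamma,\beta,q)=0$ for all $\gamma<\alpha$. For $c\in\mathcal{MS}_\kappa$: - $d_c(\alpha,\beta)=\inf\{q\in\mathbb{Q}_{>0}\mid c(\alpha,\beta,q)=1\}$ is a metric on $\kappa$. - $M_c$ is the completion of $(\kappa,d_c)$; it is a complete metric space of density character $\kappa$. *)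

theory Defs
  imports "HOL-Analysis.Analysis"
begin

unbundle cardinal_syntax

text \<open>
  A cardinal \<open>\<kappa>\<close> is a type \<open>'k\<close> together with a relation \<open>r\<close> satisfying \<^term>\<open>card_order r\<close>,
  i.e. a wellorder of the whole type whose order type is an initial ordinal. The elements of \<open>'k\<close>
  are then the ordinals below \<open>\<kappa>\<close>, and \<^term>\<open>underS r \<alpha>\<close> is the set of ordinals strictly below \<open>\<alpha>\<close>.
\<close>

section \<open>The generalized Cantor space\<close>

definition basic_nbhd :: "'k rel \<Rightarrow> 'k \<Rightarrow> ('k \<Rightarrow> bool) \<Rightarrow> ('k \<Rightarrow> bool) set" where
  "basic_nbhd r \<alpha> s = {x. \<forall>\<beta>\<in>underS r \<alpha>. x \<beta> = s \<beta>}"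

definition bounded_topology :: "'k rel \<Rightarrow> ('k \<Rightarrow> bool) topology" where
  "bounded_topology r = topology_generated_by {basic_nbhd r \<alpha> s | \<alpha> s. True}"

text \<open>
  For an index set \<open>I\<close>, the elements of \<open>I\<close>-indexed Cantor space are the extensional functions on
  \<open>I\<close>. A bijection \<open>e\<close> from \<open>I\<close> to \<open>\<kappa>\<close> sends such an \<open>x\<close> to the element \<open>x \<circ> e\<^sup>-\<^sup>1\<close> of the
  \<open>\<kappa>\<close>-indexed space, along which the bounded topology is pulled back.
\<close>

definition cantor_space :: "'i set \<Rightarrow> ('i \<Rightarrow> bool) set" where
  "cantor_space I = I \<rightarrow>\<^sub>E UNIV"

definition cantor_topology :: "'k rel \<Rightarrow> 'i set \<Rightarrow> ('i \<Rightarrow> 'k) \<Rightarrow> ('i \<Rightarrow> bool) topology" where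
  "cantor_topology r I e =
     pullback_topology (cantor_space I) (\<lambda>x. x \<circ> inv_into I e) (bounded_topology r)"

section \<open>Borel sets and functions\<close>

inductive_set kborel :: "'k rel \<Rightarrow> 'a topology \<Rightarrow> 'a set set" for r X where
  kborel_open: "openin X U \<Longrightarrow> U \<in> kborel r X"
| kborel_compl: "A \<in> kborel r X \<Longrightarrow> topspace X - A \<in> kborel r X"
| kborel_Union: "|\<F>| \<le>o r \<Longrightarrow> \<forall>A\<in>\<F>. A \<in> kborel r X \<Longrightarrow> \<Union>\<F> \<in> kborel r X"

definition rel_kborel :: "'k rel \<Rightarrow> 'a topology \<Rightarrow> 'a set \<Rightarrow> 'a set set" where
  "rel_kborel r X S = {S \<inter> B | B. B \<in> kborel r X}"

definition kborel_fun ::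
  "'k rel \<Rightarrow> 'a topology \<Rightarrow> 'a set \<Rightarrow> 'b topology \<Rightarrow> 'b set \<Rightarrow> ('a \<Rightarrow> 'b) \<Rightarrow> bool" where
  "kborel_fun r X S Y T f \<longleftrightarrow>
     f \<in> S \<rightarrow> T \<and> (\<forall>B\<in>rel_kborel r Y T. {x\<in>S. f x \<in> B} \<in> rel_kborel r X S)"

section \<open>Graphs\<close>

definition GRAPHS :: "('k \<times> 'k \<Rightarrow> bool) set" where
  "GRAPHS = {G. (\<forall>\<alpha> \<beta>. G (\<alpha>, \<beta>) \<longrightarrow> G (\<beta>, \<alpha>)) \<and> (\<forall>\<alpha>. \<not> G (\<alpha>, \<alpha>))}"

definition graph_iso :: "('k \<times> 'k \<Rightarrow> bool) \<Rightarrow> ('k \<times> 'k \<Rightarrow> bool) \<Rightarrow> bool" where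
  "graph_iso G H \<longleftrightarrow> (\<exists>\<pi>. bij \<pi> \<and> (\<forall>\<alpha> \<beta>. G (\<alpha>, \<beta>) \<longleftrightarrow> H (\<pi> \<alpha>, \<pi> \<beta>)))"

section \<open>Codes for complete metric spaces\<close>

definition MS_index :: "('k \<times> 'k \<times> rat) set" where
  "MS_index = UNIV \<times> UNIV \<times> {q. 0 < q}"

definition MS :: "'k rel \<Rightarrow> ('k \<times> 'k \<times> rat \<Rightarrow> bool) set" where
  "MS r = {c \<in> cantor_space MS_index.
     (\<forall>\<alpha> \<beta> q q'. 0 < q \<and> q \<le> q' \<longrightarrow> c (\<alpha>, \<beta>, q) \<longrightarrow> c (\<alpha>, \<beta>, q')) \<and>
     (\<forall>\<alpha> \<beta>. \<exists>q>0. c (\<alpha>, \<beta>, q)) \<and>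
     (\<forall>\<alpha>. \<forall>q>0. c (\<alpha>, \<alpha>, q)) \<and>
     (\<forall>\<beta>. \<forall>\<alpha>\<in>underS r \<beta>. \<exists>q>0. \<not> c (\<alpha>, \<beta>, q)) \<and>
     (\<forall>\<alpha> \<beta>. \<forall>q>0. c (\<alpha>, \<beta>, q) = c (\<beta>, \<alpha>, q)) \<and>
     (\<forall>\<alpha> \<beta> \<gamma>. \<forall>q>0. \<forall>q'>0. c (\<alpha>, \<beta>, q) \<and> c (\<beta>, \<gamma>, q') \<longrightarrow> c (\<alpha>, \<gamma>, q + q')) \<and>
     (\<forall>\<alpha>. \<exists>\<beta>. \<exists>q>0. \<forall>\<gamma>\<in>underS r \<alpha>. \<not> c (\<gamma>, \<beta>, q))}"

definition code_dist :: "('k \<times> 'k \<times> rat \<Rightarrow> bool) \<Rightarrow> 'k \<Rightarrow> 'k \<Rightarrow> real" where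
  "code_dist c \<alpha> \<beta> = Inf {real_of_rat q | q. 0 < q \<and> c (\<alpha>, \<beta>, q)}"

lemma code_dist_metric:
  assumes r: "card_order r" and c: "c \<in> MS r"
  shows "Metric_space UNIV (code_dist c)"
proof -
  note c' = c[unfolded MS_def mem_Collect_eq, THEN conjunct2]
  note c2 = c'[THEN conjunct2] note c3 = c2[THEN conjunct2] note c4 = c3[THEN conjunct2]
  note c5 = c4[THEN conjunct2] note c6 = c5[THEN conjunct2]
  have mono: "c (\<alpha>, \<beta>, q')" if "0 < q" "q \<le> q'" "c (\<alpha>, \<beta>, q)" for \<alpha> \<beta> q q'
    using c'[THEN conjunct1, rule_format] that by meson
  note ex = c2[THEN conjunct1, rule_format]
  note refl = c3[THEN conjunct1, rule_format]
  note sep = c4[THEN conjunct1, rule_format]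
  note sym = c5[THEN conjunct1, rule_format]
  have tri: "c (\<alpha>, \<gamma>, q + q')" if "q > 0" "q' > 0" "c (\<alpha>, \<beta>, q)" "c (\<beta>, \<gamma>, q')" for \<alpha> \<beta> \<gamma> q q'
    using c6[THEN conjunct1, rule_format, OF that(1,2)] that(3,4) by meson
  define S where "S \<alpha> \<beta> = {real_of_rat q | q. 0 < q \<and> c (\<alpha>, \<beta>, q)}" for \<alpha> \<beta>
  have D: "code_dist c \<alpha> \<beta> = Inf (S \<alpha> \<beta>)" for \<alpha> \<beta> by (simp add: code_dist_def S_def)
  have ne: "S \<alpha> \<beta> \<noteq> {}" for \<alpha> \<beta> using ex[of \<alpha> \<beta>] by (auto simp: S_def)
  have pos: "0 \<le> x" if "x \<in> S \<alpha> \<beta>" for x \<alpha> \<beta> using that by (auto simp: S_def)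
  have bdd: "bdd_below (S \<alpha> \<beta>)" for \<alpha> \<beta> using pos by (meson bdd_belowI)
  have comm: "S \<alpha> \<beta> = S \<beta> \<alpha>" for \<alpha> \<beta> unfolding S_def
    by (rule Collect_cong) (metis sym)
  have zero: "Inf (S \<alpha> \<alpha>) = 0" for \<alpha>
  proof (rule antisym)
    show "Inf (S \<alpha> \<alpha>) \<le> 0"
    proof (rule field_le_epsilon)
      fix e :: real assume "0 < e"
      then obtain q where q: "0 < real_of_rat q" "real_of_rat q < e"
        using of_rat_dense by blast
      then have "real_of_rat q \<in> S \<alpha> \<alpha>" using refl by (auto simp: S_def)
      then have "Inf (S \<alpha> \<alpha>) \<le> real_of_rat q" using bdd by (rule cInf_lower)
      then show "Inf (S \<alpha> \<alpha>) \<le> 0 + e" using q by simp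
    qed
    show "0 \<le> Inf (S \<alpha> \<alpha>)" using ne pos by (intro cInf_greatest)
  qed
  have gt: "0 < Inf (S \<alpha> \<beta>)" if lt: "\<alpha> \<in> underS r \<beta>" for \<alpha> \<beta>
  proof -
    obtain q where q: "q > 0" "\<not> c (\<alpha>, \<beta>, q)" using sep[OF lt] by blast
    have "real_of_rat q \<le> x" if x: "x \<in> S \<alpha> \<beta>" for x
    proof -
      obtain p where p: "x = real_of_rat p" "0 < p" "c (\<alpha>, \<beta>, p)" using x by (auto simp: S_def)
      have "\<not> p \<le> q" using mono p q by blast
      then show ?thesis using p by (simp add: of_rat_less_eq)
    qed
    then have "real_of_rat q \<le> Inf (S \<alpha> \<beta>)" using ne by (intro cInf_greatest)
    then show ?thesis using q by (meson less_le_trans zero_less_of_rat_iff)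
  qed
  have lin: "\<alpha> = \<beta> \<or> \<alpha> \<in> underS r \<beta> \<or> \<beta> \<in> underS r \<alpha>" for \<alpha> \<beta>
  proof -
    have "total_on UNIV r"
      using r by (simp add: card_order_on_def well_order_on_def linear_order_on_def)
    then show ?thesis by (auto simp: total_on_def underS_def)
  qed
  show ?thesis
  proof
    fix \<alpha> \<beta> show "0 \<le> code_dist c \<alpha> \<beta>" unfolding D using ne pos by (intro cInf_greatest)
    show "code_dist c \<alpha> \<beta> = code_dist c \<beta> \<alpha>" by (simp add: D comm)
    show "code_dist c \<alpha> \<beta> = 0 \<longleftrightarrow> \<alpha> = \<beta>"
      using lin[of \<alpha> \<beta>] gt zero comm by (metis D less_irrefl)
  next
    fix \<alpha> \<beta> \<gamma>
    have "Inf (S \<alpha> \<gamma>) \<le> x + y" if xy: "x \<in> S \<alpha> \<beta>" "y \<in> S \<beta> \<gamma>" for x y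
    proof -
      obtain p q where p: "x = real_of_rat p" "0 < p" "c (\<alpha>, \<beta>, p)"
        and q: "y = real_of_rat q" "0 < q" "c (\<beta>, \<gamma>, q)" using xy unfolding S_def by blast
      have "x + y = real_of_rat (p + q)" "0 < p + q" using p q by (simp_all add: of_rat_add)
      then have "x + y \<in> S \<alpha> \<gamma>" using tri[OF p(2) q(2) p(3) q(3)] unfolding S_def by blast
      then show ?thesis using bdd by (rule cInf_lower)
    qed
    note le = this
    have le': "Inf (S \<alpha> \<gamma>) - x \<le> Inf (S \<beta> \<gamma>)" if x: "x \<in> S \<alpha> \<beta>" for x
    proof (rule cInf_greatest[OF ne])
      fix y assume "y \<in> S \<beta> \<gamma>"
      from le[OF x this] show "Inf (S \<alpha> \<gamma>) - x \<le> y" by linarith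
    qed
    have "Inf (S \<alpha> \<gamma>) - Inf (S \<beta> \<gamma>) \<le> Inf (S \<alpha> \<beta>)"
    proof (rule cInf_greatest[OF ne])
      fix x assume "x \<in> S \<alpha> \<beta>"
      from le'[OF this] show "Inf (S \<alpha> \<gamma>) - Inf (S \<beta> \<gamma>) \<le> x" by linarith
    qed
    then show "code_dist c \<alpha> \<gamma> \<le> code_dist c \<alpha> \<beta> + code_dist c \<beta> \<gamma>" by (simp add: D)
  qed
qed

section \<open>Completion, isometry and density character\<close>

abbreviation Cauchy_seqs :: "'a metric \<Rightarrow> (nat \<Rightarrow> 'a) set" where
  "Cauchy_seqs m \<equiv> {\<sigma>. Metric_space.MCauchy (mspace m) (mdist m) \<sigma>}"

definition Cauchy_equiv :: "'a metric \<Rightarrow> (nat \<Rightarrow> 'a) rel" where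
  "Cauchy_equiv m = {(\<sigma>, \<tau>). \<sigma> \<in> Cauchy_seqs m \<and> \<tau> \<in> Cauchy_seqs m \<and>
     (\<lambda>n. mdist m (\<sigma> n) (\<tau> n)) \<longlonglongrightarrow> 0}"

text \<open>The value 0 outside the carrier is forced on us: \<^locale>\<open>Metric_space\<close> demands that the distance
  be nonnegative and symmetric on the whole type.\<close>

definition completion_dist :: "'a metric \<Rightarrow> (nat \<Rightarrow> 'a) set \<Rightarrow> (nat \<Rightarrow> 'a) set \<Rightarrow> real" where
  "completion_dist m A B =
     (if A \<in> Cauchy_seqs m // Cauchy_equiv m \<and> B \<in> Cauchy_seqs m // Cauchy_equiv m
      then THE l. \<forall>\<sigma>\<in>A. \<forall>\<tau>\<in>B. (\<lambda>n. mdist m (\<sigma> n) (\<tau> n)) \<longlonglongrightarrow> l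
      else 0)"

definition completion :: "'a metric \<Rightarrow> (nat \<Rightarrow> 'a) set metric" where
  "completion m = metric (Cauchy_seqs m // Cauchy_equiv m, completion_dist m)"

text \<open>
  The constructor \<^const>\<open>metric\<close> is meaningful only on actual metric spaces; for \<^const>\<open>completion\<close>
  this is the content of the next lemmas.
\<close>

lemma Cauchy_dist_convergent:
  assumes "\<sigma> \<in> Cauchy_seqs m" "\<tau> \<in> Cauchy_seqs m"
  shows "convergent (\<lambda>n. mdist m (\<sigma> n) (\<tau> n))"
proof -
  interpret Metric_space "mspace m" "mdist m" by simp
  have in_m: "\<sigma> n \<in> mspace m" "\<tau> n \<in> mspace m" for n
    using assms by (auto simp: MCauchy_def)
  have "Cauchy (\<lambda>n. mdist m (\<sigma> n) (\<tau> n))"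
    unfolding Cauchy_def
  proof (intro allI impI)
    fix e :: real assume "0 < e"
    then have e2: "e / 2 > 0" by simp
    obtain N1 where N1: "\<And>n n'. N1 \<le> n \<Longrightarrow> N1 \<le> n' \<Longrightarrow> mdist m (\<sigma> n) (\<sigma> n') < e / 2"
      using assms(1) e2 unfolding MCauchy_def mem_Collect_eq by metis
    obtain N2 where N2: "\<And>n n'. N2 \<le> n \<Longrightarrow> N2 \<le> n' \<Longrightarrow> mdist m (\<tau> n) (\<tau> n') < e / 2"
      using assms(2) e2 unfolding MCauchy_def mem_Collect_eq by metis
    show "\<exists>M. \<forall>i\<ge>M. \<forall>j\<ge>M. dist (mdist m (\<sigma> i) (\<tau> i)) (mdist m (\<sigma> j) (\<tau> j)) < e"
    proof (intro exI allI impI)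
      fix i j assume ij: "max N1 N2 \<le> i" "max N1 N2 \<le> j"
      have s: "mdist m (\<sigma> i) (\<sigma> j) < e / 2" "mdist m (\<tau> i) (\<tau> j) < e / 2"
        using N1 N2 ij by auto
      have "mdist m (\<sigma> i) (\<tau> i) \<le> mdist m (\<sigma> i) (\<sigma> j) + mdist m (\<sigma> j) (\<tau> j) + mdist m (\<tau> i) (\<tau> j)"
        using triangle[of "\<sigma> i" "\<sigma> j" "\<tau> i"] triangle[of "\<sigma> j" "\<tau> j" "\<tau> i"]
        by (simp add: in_m commute)
      moreover have "mdist m (\<sigma> j) (\<tau> j) \<le> mdist m (\<sigma> i) (\<sigma> j) + mdist m (\<sigma> i) (\<tau> i) + mdist m (\<tau> i) (\<tau> j)"
        using triangle[of "\<sigma> j" "\<sigma> i" "\<tau> j"] triangle[of "\<sigma> i" "\<tau> i" "\<tau> j"]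
        by (simp add: in_m commute)
      ultimately show "dist (mdist m (\<sigma> i) (\<tau> i)) (mdist m (\<sigma> j) (\<tau> j)) < e"
        using s by (simp add: dist_real_def)
    qed
  qed
  then show ?thesis by (simp add: Cauchy_convergent_iff)
qed

lemma equiv_Cauchy: "equiv (Cauchy_seqs m) (Cauchy_equiv m)"
proof -
  interpret Metric_space "mspace m" "mdist m" by simp
  have in_m: "\<sigma> n \<in> mspace m" if "MCauchy \<sigma>" for \<sigma> n
    using that by (auto simp: MCauchy_def)
  show ?thesis
  proof (rule equivI)
    show "Cauchy_equiv m \<subseteq> Cauchy_seqs m \<times> Cauchy_seqs m"
      by (auto simp: Cauchy_equiv_def)
    show "refl_on (Cauchy_seqs m) (Cauchy_equiv m)"
      by (auto simp: refl_on_def Cauchy_equiv_def in_m)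
    show "sym (Cauchy_equiv m)"
      by (auto simp: sym_def Cauchy_equiv_def commute)
    show "trans (Cauchy_equiv m)"
    proof (rule transI)
      fix x y z assume xy: "(x, y) \<in> Cauchy_equiv m" and yz: "(y, z) \<in> Cauchy_equiv m"
      have C: "MCauchy x" "MCauchy y" "MCauchy z" using xy yz by (auto simp: Cauchy_equiv_def)
      have lim0: "(\<lambda>n. mdist m (x n) (y n) + mdist m (y n) (z n)) \<longlonglongrightarrow> 0 + 0"
        using xy yz by (intro tendsto_add) (auto simp: Cauchy_equiv_def)
      have "norm (mdist m (x n) (z n)) \<le> mdist m (x n) (y n) + mdist m (y n) (z n)" for n
        using triangle[OF in_m[OF C(1)] in_m[OF C(2)] in_m[OF C(3)]] by simp
      then have "(\<lambda>n. mdist m (x n) (z n)) \<longlonglongrightarrow> 0"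
        by (intro Lim_null_comparison[OF always_eventually[OF allI] lim0[unfolded add_0]])
      then show "(x, z) \<in> Cauchy_equiv m" using C by (auto simp: Cauchy_equiv_def)
    qed
  qed
qed

lemma completion_dist_tendsto:
  assumes A: "A \<in> Cauchy_seqs m // Cauchy_equiv m" and B: "B \<in> Cauchy_seqs m // Cauchy_equiv m"
    and "\<sigma> \<in> A" "\<tau> \<in> B"
  shows "(\<lambda>n. mdist m (\<sigma> n) (\<tau> n)) \<longlonglongrightarrow> completion_dist m A B"
proof -
  interpret Metric_space "mspace m" "mdist m" by simp
  have in_m: "\<rho> n \<in> mspace m" if "MCauchy \<rho>" for \<rho> n
    using that by (auto simp: MCauchy_def)
  have C: "\<rho> \<in> Cauchy_seqs m" if "\<rho> \<in> A \<or> \<rho> \<in> B" for \<rho>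
    using that in_quotient_imp_subset[OF equiv_Cauchy A] in_quotient_imp_subset[OF equiv_Cauchy B]
    by auto
  obtain l where l: "(\<lambda>n. mdist m (\<sigma> n) (\<tau> n)) \<longlonglongrightarrow> l"
    using Cauchy_dist_convergent[of \<sigma> m \<tau>] C assms(3,4) by (auto simp: convergent_def)
  have all: "(\<lambda>n. mdist m (\<sigma>' n) (\<tau>' n)) \<longlonglongrightarrow> l" if "\<sigma>' \<in> A" "\<tau>' \<in> B" for \<sigma>' \<tau>'
  proof -
    have "(\<sigma>, \<sigma>') \<in> Cauchy_equiv m" "(\<tau>, \<tau>') \<in> Cauchy_equiv m"
      using quotient_eq_iff[OF equiv_Cauchy A A] quotient_eq_iff[OF equiv_Cauchy B B] assms(3,4) that by auto
    then have lim0: "(\<lambda>n. mdist m (\<sigma> n) (\<sigma>' n) + mdist m (\<tau> n) (\<tau>' n)) \<longlonglongrightarrow> 0 + 0"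
      by (intro tendsto_add) (auto simp: Cauchy_equiv_def)
    have i: "\<sigma> n \<in> mspace m" "\<tau> n \<in> mspace m" "\<sigma>' n \<in> mspace m" "\<tau>' n \<in> mspace m" for n
      using C assms(3,4) that in_m by auto
    have "norm (mdist m (\<sigma>' n) (\<tau>' n) - mdist m (\<sigma> n) (\<tau> n))
        \<le> mdist m (\<sigma> n) (\<sigma>' n) + mdist m (\<tau> n) (\<tau>' n)" for n
      using triangle[of "\<sigma> n" "\<sigma>' n" "\<tau> n"] triangle[of "\<sigma>' n" "\<tau>' n" "\<tau> n"]
        triangle[of "\<sigma>' n" "\<sigma> n" "\<tau>' n"] triangle[of "\<sigma> n" "\<tau> n" "\<tau>' n"] commute
      by (simp add: i abs_le_iff commute)
    then have "(\<lambda>n. mdist m (\<sigma>' n) (\<tau>' n) - mdist m (\<sigma> n) (\<tau> n)) \<longlonglongrightarrow> 0"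
      by (intro Lim_null_comparison[OF always_eventually[OF allI] lim0[unfolded add_0]])
    from tendsto_add[OF this l] show ?thesis by simp
  qed
  have "completion_dist m A B = l"
    unfolding completion_dist_def if_P[OF conjI[OF A B]]
  proof (rule the_equality)
    show "\<forall>\<sigma>\<in>A. \<forall>\<tau>\<in>B. (\<lambda>n. mdist m (\<sigma> n) (\<tau> n)) \<longlonglongrightarrow> l" using all by blast
    fix l' assume "\<forall>\<sigma>\<in>A. \<forall>\<tau>\<in>B. (\<lambda>n. mdist m (\<sigma> n) (\<tau> n)) \<longlonglongrightarrow> l'"
    then have "(\<lambda>n. mdist m (\<sigma> n) (\<tau> n)) \<longlonglongrightarrow> l'" using assms(3,4) by blast
    then show "l' = l" using l by (rule LIMSEQ_unique)
  qed
  then show ?thesis using l by simp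
qed

lemma completion_metric:
  "Metric_space (Cauchy_seqs m // Cauchy_equiv m) (completion_dist m)"
proof -
  interpret Metric_space "mspace m" "mdist m" by simp
  let ?Q = "Cauchy_seqs m // Cauchy_equiv m"
  have in_m: "\<rho> n \<in> mspace m" if "\<rho> \<in> A" "A \<in> ?Q" for \<rho> A n
    using that in_quotient_imp_subset[OF equiv_Cauchy, of A m] by (auto simp: MCauchy_def)
  have nonempty: "\<exists>\<sigma>. \<sigma> \<in> A" if "A \<in> ?Q" for A
    using that in_quotient_imp_non_empty[OF equiv_Cauchy] by blast
  have "0 \<le> completion_dist m A B \<and> completion_dist m A B = completion_dist m B A
      \<and> (completion_dist m A B = 0 \<longleftrightarrow> A = B)"
    if AB: "A \<in> ?Q" "B \<in> ?Q" for A B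
  proof -
    obtain \<sigma> \<tau> where st: "\<sigma> \<in> A" "\<tau> \<in> B" using nonempty AB by blast
    note l = completion_dist_tendsto[OF AB st]
    have "completion_dist m A B = completion_dist m B A"
      using l completion_dist_tendsto[OF AB(2,1) st(2,1)] LIMSEQ_unique by (simp add: commute)
    moreover have "completion_dist m A B = 0 \<longleftrightarrow> (\<sigma>, \<tau>) \<in> Cauchy_equiv m"
    proof -
      have "\<sigma> \<in> Cauchy_seqs m" "\<tau> \<in> Cauchy_seqs m"
        using in_quotient_imp_subset[OF equiv_Cauchy] AB st by blast+
      then have "(\<sigma>, \<tau>) \<in> Cauchy_equiv m \<longleftrightarrow> (\<lambda>n. mdist m (\<sigma> n) (\<tau> n)) \<longlonglongrightarrow> 0"
        by (simp add: Cauchy_equiv_def)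
      then show ?thesis using l LIMSEQ_unique by metis
    qed
    moreover have "\<dots> \<longleftrightarrow> A = B"
      using quotient_eq_iff[OF equiv_Cauchy AB st] by simp
    moreover have "0 \<le> completion_dist m A B"
      using l by (rule LIMSEQ_le_const) auto
    ultimately show ?thesis by simp
  qed
  note basic = this
  have out: "completion_dist m A B = 0" if "\<not> (A \<in> ?Q \<and> B \<in> ?Q)" for A B
    using that unfolding completion_dist_def by (rule if_not_P)
  show ?thesis
  proof
    fix A B
    show "0 \<le> completion_dist m A B" using basic[of A B] out[of A B] by (cases "A \<in> ?Q \<and> B \<in> ?Q") auto
    show "completion_dist m A B = completion_dist m B A"
      using basic[of A B] out[of A B] out[of B A] by (cases "A \<in> ?Q \<and> B \<in> ?Q") auto
  next
    fix A B assume "A \<in> ?Q" "B \<in> ?Q"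
    then show "completion_dist m A B = 0 \<longleftrightarrow> A = B" using basic by blast
  next
    fix A B C assume ABC: "A \<in> ?Q" "B \<in> ?Q" "C \<in> ?Q"
    obtain \<sigma> \<tau> \<rho> where s: "\<sigma> \<in> A" "\<tau> \<in> B" "\<rho> \<in> C" using nonempty[OF ABC(1)] nonempty[OF ABC(2)] nonempty[OF ABC(3)] by blast
    show "completion_dist m A C \<le> completion_dist m A B + completion_dist m B C"
    proof (rule LIMSEQ_le)
      show "(\<lambda>n. mdist m (\<sigma> n) (\<rho> n)) \<longlonglongrightarrow> completion_dist m A C"
        using ABC(1,3) s(1,3) by (rule completion_dist_tendsto)
      show "(\<lambda>n. mdist m (\<sigma> n) (\<tau> n) + mdist m (\<tau> n) (\<rho> n))
          \<longlonglongrightarrow> completion_dist m A B + completion_dist m B C"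
        by (rule tendsto_add[OF completion_dist_tendsto[OF ABC(1,2) s(1,2)]
              completion_dist_tendsto[OF ABC(2,3) s(2,3)]])
      show "\<exists>N. \<forall>n\<ge>N. mdist m (\<sigma> n) (\<rho> n) \<le> mdist m (\<sigma> n) (\<tau> n) + mdist m (\<tau> n) (\<rho> n)"
        using triangle[OF in_m[OF s(1) ABC(1)] in_m[OF s(2) ABC(2)] in_m[OF s(3) ABC(3)]] by meson
    qed
  qed
qed

lemma mspace_completion: "mspace (completion m) = Cauchy_seqs m // Cauchy_equiv m"
  and mdist_completion: "mdist (completion m) = completion_dist m"
  unfolding completion_def
  by (rule Metric_space.mspace_metric[OF completion_metric],
      rule Metric_space.mdist_metric[OF completion_metric])

definition code_space :: "('k \<times> 'k \<times> rat \<Rightarrow> bool) \<Rightarrow> (nat \<Rightarrow> 'k) set metric" where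
  "code_space c = completion (metric (UNIV, code_dist c))"

definition isometric :: "'a metric \<Rightarrow> 'b metric \<Rightarrow> bool" where
  "isometric m m' \<longleftrightarrow> (\<exists>h. bij_betw h (mspace m) (mspace m') \<and>
     (\<forall>x\<in>mspace m. \<forall>y\<in>mspace m. mdist m' (h x) (h y) = mdist m x y))"

definition discrete_space :: "'a metric \<Rightarrow> bool" where
  "discrete_space m \<longleftrightarrow> mtopology_of m = discrete_topology (mspace m)"

definition dense_subset :: "'a metric \<Rightarrow> 'a set \<Rightarrow> bool" where
  "dense_subset m D \<longleftrightarrow> D \<subseteq> mspace m \<and> mtopology_of m closure_of D = mspace m"

definition has_density_character :: "'a metric \<Rightarrow> 'k rel \<Rightarrow> bool" where
  "has_density_character m r \<longleftrightarrow>
     (\<exists>D. dense_subset m D \<and> |D| =o r) \<and> (\<forall>D. dense_subset m D \<longrightarrow> r \<le>o |D| )"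

end

theory Submission
  imports Defs
begin

text \<open>
  A graph \<open>G\<close> is turned into a metric space whose points are the vertices together with one point for
  every ordered pair of vertices. All distances between distinct points are 2, except that the point
  of \<open>(b, c)\<close> has distance 1 (if \<open>(b, c)\<close> is an edge) or 3/2 (if not) from \<open>b\<close> and \<open>c\<close>. Vertices are
  recognised as the points with infinitely many others at distance below 2, so isometries are induced
  by graph isomorphisms.

  The obvious coding, with \<open>\<kappa>\<close> as the set of points and distances 1 and 2 for edges and non-edges,
  may fail to be Borel if \<open>\<kappa>\<close> is singular: fewer than \<open>\<kappa>\<close> coordinates of the code may depend on
  unboundedly many coordinates of \<open>G\<close>, and there may be more than \<open>\<kappa>\<close> basic open sets. With points
  for pairs, every distance depends on at most one pair for each of the two points involved, and the
  pairs can be placed late enough in \<open>\<kappa>\<close> that the coordinates of the code below \<open>\<gamma>\<close> depend only on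
  those of \<open>G\<close> below \<open>\<gamma>\<close>. The reduction is then continuous, whatever the bijections \<open>e\<^sub>2\<close> and \<open>e\<^sub>3\<close>.
\<close>

section \<open>Continuity and Borel functions\<close>

lemma basic_nbhd_self: "x \<in> basic_nbhd r \<alpha> x"
  by (simp add: basic_nbhd_def)

text \<open>Initial segments are linearly ordered by inclusion, so the basic neighbourhoods of a
  point form a chain. Hence the generating sets are already a base, and openness can be tested point
  by point.\<close>

lemma openin_bounded_topology:
  fixes r :: "'k rel"
  assumes r: "card_order r"
  shows "openin (bounded_topology r) V \<longleftrightarrow> (\<forall>x\<in>V. \<exists>\<alpha>. basic_nbhd r \<alpha> x \<subseteq> V)"
proof
  have wo: "Well_order r" "Field r = UNIV"
    using card_order_on_Card_order[OF r] card_order_on_well_order_on by blast+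
  have lin: "underS r \<alpha> \<subseteq> underS r \<beta> \<or> underS r \<beta> \<subseteq> underS r \<alpha>" for \<alpha> \<beta>
    using wo by (metis UNIV_I linear_order_on_def partial_order_on_def preorder_on_def
        underS_incr total_on_def well_order_on_def subset_refl)
  have mono: "basic_nbhd r \<beta> x \<subseteq> basic_nbhd r \<alpha> x"
    if "underS r \<alpha> \<subseteq> underS r \<beta>" for \<alpha> \<beta> x
    using that by (auto simp: basic_nbhd_def)
  assume "openin (bounded_topology r) V"
  then have "generate_topology_on {basic_nbhd r \<alpha> s | \<alpha> s. True} V"
    by (simp add: bounded_topology_def openin_topology_generated_by_iff)
  then show "\<forall>x\<in>V. \<exists>\<alpha>. basic_nbhd r \<alpha> x \<subseteq> V"
  proof induction
    case Empty
    show ?case by simp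
  next
    case (Int A B)
    show ?case
    proof
      fix x assume x: "x \<in> A \<inter> B"
      obtain \<alpha> \<beta> where "basic_nbhd r \<alpha> x \<subseteq> A" "basic_nbhd r \<beta> x \<subseteq> B" using Int x by blast
      then show "\<exists>\<alpha>. basic_nbhd r \<alpha> x \<subseteq> A \<inter> B"
        using lin[of \<alpha> \<beta>] mono by (meson Int_greatest subset_trans)
    qed
  next
    case (UN K)
    then show ?case by (meson UnionE Union_upper subset_trans)
  next
    case (Basis s)
    then show ?case by (fastforce simp: basic_nbhd_def)
  qed
next
  assume V: "\<forall>x\<in>V. \<exists>\<alpha>. basic_nbhd r \<alpha> x \<subseteq> V"
  have "V = \<Union>{basic_nbhd r \<alpha> x | \<alpha> x. basic_nbhd r \<alpha> x \<subseteq> V}"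
    using V basic_nbhd_self by fast
  moreover have "openin (bounded_topology r) (\<Union>{basic_nbhd r \<alpha> x | \<alpha> x. basic_nbhd r \<alpha> x \<subseteq> V})"
  proof (rule openin_Union)
    fix B assume "B \<in> {basic_nbhd r \<alpha> x | \<alpha> x. basic_nbhd r \<alpha> x \<subseteq> V}"
    then show "openin (bounded_topology r) B"
      unfolding bounded_topology_def by (intro topology_generated_by_Basis) blast
  qed
  ultimately show "openin (bounded_topology r) V" by simp
qed

lemma topspace_bounded_topology:
  assumes "card_order r"
  shows "topspace (bounded_topology r) = UNIV"
  using openin_bounded_topology[OF assms, of UNIV] openin_subset by fastforce

lemma topspace_cantor_topology:
  assumes "card_order r"
  shows "topspace (cantor_topology r I e) = cantor_space I"
  by (simp add: cantor_topology_def topspace_pullback_topology topspace_bounded_topology[OF assms])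

text \<open>By \<open>loc\<close>, agreement below \<gamma> is preserved with the same \<gamma>, so
  \<open>F\<close> maps the neighbourhood of x at level \<gamma> into that of \<open>F x\<close> at
  level \<gamma>. No supremum of fewer than \<kappa> levels has to be formed, so singular \<kappa>
  is covered.\<close>

lemma continuous_map_cantor_topology:
  fixes F :: "('i \<Rightarrow> bool) \<Rightarrow> 'j \<Rightarrow> bool"
  assumes r: "card_order r" and e: "bij_betw e I UNIV" and e': "bij_betw e' J UNIV"
    and F: "F \<in> cantor_space I \<rightarrow> cantor_space J"
    and loc: "\<And>\<gamma> x y j. (\<And>i. i \<in> I \<Longrightarrow> e i \<in> underS r \<gamma> \<Longrightarrow> x i = y i) \<Longrightarrow>
      j \<in> J \<Longrightarrow> e' j \<in> underS r \<gamma> \<Longrightarrow> F x j = F y j"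
  shows "continuous_map (cantor_topology r I e) (cantor_topology r J e') F"
proof (rule continuous_map[THEN iffD2], intro conjI allI impI)
  show "F ` topspace (cantor_topology r I e) \<subseteq> topspace (cantor_topology r J e')"
    using F by (auto simp: topspace_cantor_topology[OF r])
  fix U assume "openin (cantor_topology r J e') U"
  then obtain V where V: "openin (bounded_topology r) V"
    and U: "U = (\<lambda>x. x \<circ> inv_into J e') -` V \<inter> cantor_space J"
    by (auto simp: cantor_topology_def openin_pullback_topology)
  \<comment> \<open>The level \<gamma> is read off at \<open>F x\<close> in the target and used
    unchanged at x in the source; the trace of \<open>W\<close> is then exactly the preimage of
    \<open>U\<close>.\<close>
  define W where "W = \<Union>{basic_nbhd r \<gamma> (x \<circ> inv_into I e) | \<gamma> x. x \<in> cantor_space I \<and>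
    basic_nbhd r \<gamma> (F x \<circ> inv_into J e') \<subseteq> V}"
  have "openin (bounded_topology r) W"
    unfolding W_def
  proof (rule openin_Union)
    fix B assume "B \<in> {basic_nbhd r \<gamma> (x \<circ> inv_into I e) | \<gamma> x. x \<in> cantor_space I \<and>
      basic_nbhd r \<gamma> (F x \<circ> inv_into J e') \<subseteq> V}"
    then show "openin (bounded_topology r) B"
      unfolding bounded_topology_def by (intro topology_generated_by_Basis) blast
  qed
  moreover have "{x \<in> cantor_space I. F x \<in> U} = (\<lambda>x. x \<circ> inv_into I e) -` W \<inter> cantor_space I"
    (is "?L = ?R")
  proof (rule set_eqI, rule iffI)
    fix x assume x: "x \<in> ?L"
    then have "F x \<circ> inv_into J e' \<in> V" by (simp add: U)
    then obtain \<gamma> where "basic_nbhd r \<gamma> (F x \<circ> inv_into J e') \<subseteq> V"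
      using V openin_bounded_topology[OF r] by blast
    then show "x \<in> ?R" unfolding W_def using x basic_nbhd_self by fastforce
  next
    fix y assume y: "y \<in> ?R"
    then obtain \<gamma> x where yx: "y \<circ> inv_into I e \<in> basic_nbhd r \<gamma> (x \<circ> inv_into I e)"
      and x: "x \<in> cantor_space I" "basic_nbhd r \<gamma> (F x \<circ> inv_into J e') \<subseteq> V"
      unfolding W_def by blast
    have agree: "y i = x i" if "i \<in> I" "e i \<in> underS r \<gamma>" for i
      using yx that bij_betw_inv_into_left[OF e that(1)] by (auto simp: basic_nbhd_def)
    have "F y \<circ> inv_into J e' \<in> basic_nbhd r \<gamma> (F x \<circ> inv_into J e')"
      unfolding basic_nbhd_def
    proof (intro CollectI ballI)
      fix \<beta> assume "\<beta> \<in> underS r \<gamma>"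
      moreover have "inv_into J e' \<beta> \<in> J" "e' (inv_into J e' \<beta>) = \<beta>"
        using e' by (auto simp: bij_betw_def inv_into_into f_inv_into_f)
      ultimately show "(F y \<circ> inv_into J e') \<beta> = (F x \<circ> inv_into J e') \<beta>"
        using loc[of \<gamma> y x, OF agree] by simp
    qed
    then show "y \<in> ?L" using x y F by (auto simp: U)
  qed
  ultimately show "openin (cantor_topology r I e) {x \<in> topspace (cantor_topology r I e). F x \<in> U}"
    unfolding topspace_cantor_topology[OF r]
    by (auto simp: cantor_topology_def openin_pullback_topology)
qed

text \<open>Induction on the generation of a Borel set of \<open>Y\<close>, producing a Borel set of
  the ambient space \<open>X\<close> whose trace on \<open>S\<close> is the preimage. For unions one
  such set is chosen per member, and the chosen family is no larger than the given one.\<close>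

lemma continuous_map_imp_kborel_fun:
  assumes f: "continuous_map X Y f" and S: "S \<subseteq> topspace X" and T: "T \<subseteq> topspace Y"
    and fST: "f \<in> S \<rightarrow> T"
  shows "kborel_fun r X S Y T f"
proof -
  have "\<exists>B'\<in>kborel r X. {x\<in>S. f x \<in> B} = S \<inter> B'" if "B \<in> kborel r Y" for B
    using that
  proof induction
    case (kborel_open U)
    then have "openin X {x \<in> topspace X. f x \<in> U}"
      using f by (simp add: continuous_map)
    then show ?case
      using S by (intro bexI[OF _ kborel.kborel_open]) auto
  next
    case (kborel_compl A)
    then obtain B where B: "B \<in> kborel r X" "{x\<in>S. f x \<in> A} = S \<inter> B" by blast
    have "{x\<in>S. f x \<in> topspace Y - A} = S \<inter> (topspace X - B)"
      using B(2) S T fST by fastforce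
    then show ?case using kborel.kborel_compl[OF B(1)] by blast
  next
    case (kborel_Union \<F>)
    then obtain b where b: "\<And>A. A \<in> \<F> \<Longrightarrow> b A \<in> kborel r X \<and> {x\<in>S. f x \<in> A} = S \<inter> b A"
      by metis
    have "\<Union>(b ` \<F>) \<in> kborel r X"
      using kborel_Union.hyps b by (intro kborel.kborel_Union) (auto intro: ordLeq_transitive[OF card_of_image])
    moreover have "{x\<in>S. f x \<in> \<Union>\<F>} = S \<inter> \<Union>(b ` \<F>)"
      using b by blast
    ultimately show ?case by blast
  qed
  note pre = this
  show ?thesis
    unfolding kborel_fun_def
  proof (intro conjI ballI)
    fix C assume "C \<in> rel_kborel r Y T"
    then obtain B where B: "B \<in> kborel r Y" "C = T \<inter> B" by (auto simp: rel_kborel_def)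
    then have "{x\<in>S. f x \<in> C} = {x\<in>S. f x \<in> B}" using fST by auto
    then show "{x\<in>S. f x \<in> C} \<in> rel_kborel r X S"
      using pre[OF B(1)] by (auto simp: rel_kborel_def)
  qed (rule fST)
qed

section \<open>Uniformly discrete metric spaces\<close>

text \<open>A uniform gap, stronger than discreteness: it makes Cauchy sequences eventually
  constant, so that completing adds no points.\<close>

definition one_separated :: "'a metric \<Rightarrow> bool" where
  "one_separated m \<longleftrightarrow> (\<forall>x\<in>mspace m. \<forall>y\<in>mspace m. x \<noteq> y \<longrightarrow> 1 \<le> mdist m x y)"

lemma one_separated_imp_discrete_space:
  assumes "one_separated m"
  shows "discrete_space m"
proof -
  interpret Metric_space "mspace m" "mdist m" by simp
  have "openin mtopology {x}" if "x \<in> mspace m" for x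
  proof -
    have "mball x 1 = {x}"
      using assms that by (force simp: one_separated_def)
    then show ?thesis by (metis openin_mball)
  qed
  then show ?thesis
    unfolding discrete_space_def mtopology_of_def
    by (metis discrete_topology_unique topspace_mtopology)
qed

lemma one_separated_MCauchy:
  assumes m: "one_separated m" and \<sigma>: "Metric_space.MCauchy (mspace m) (mdist m) \<sigma>"
  obtains x where "x \<in> mspace m" "\<forall>\<^sub>F n in sequentially. \<sigma> n = x"
proof -
  interpret Metric_space "mspace m" "mdist m" by simp
  obtain N where N: "\<And>n n'. N \<le> n \<Longrightarrow> N \<le> n' \<Longrightarrow> mdist m (\<sigma> n) (\<sigma> n') < 1"
    using \<sigma> unfolding MCauchy_def by (metis zero_less_one)
  have "\<sigma> n = \<sigma> N" if "N \<le> n" for n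
  proof (rule ccontr)
    assume "\<sigma> n \<noteq> \<sigma> N"
    moreover have "\<sigma> n \<in> mspace m" "\<sigma> N \<in> mspace m" using \<sigma> by (auto simp: MCauchy_def)
    ultimately have "1 \<le> mdist m (\<sigma> n) (\<sigma> N)" using m by (simp add: one_separated_def)
    then show False using N[OF that order_refl] by simp
  qed
  then have "\<forall>\<^sub>F n in sequentially. \<sigma> n = \<sigma> N"
    unfolding eventually_sequentially by blast
  moreover have "\<sigma> N \<in> mspace m" using \<sigma> by (auto simp: MCauchy_def)
  ultimately show ?thesis using that by blast
qed

lemma one_separated_imp_mcomplete_of:
  assumes "one_separated m"
  shows "mcomplete_of m"
proof -
  interpret Metric_space "mspace m" "mdist m" by simp
  show ?thesis
    unfolding mcomplete_of_def mcomplete_def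
  proof (intro allI impI)
    fix \<sigma> assume "MCauchy \<sigma>"
    then obtain x where "x \<in> mspace m" "\<forall>\<^sub>F n in sequentially. \<sigma> n = x"
      using one_separated_MCauchy[OF assms] by blast
    then show "\<exists>x. limitin mtopology \<sigma> x sequentially"
      by (intro exI[of _ x] limitin_eventually) auto
  qed
qed

text \<open>Every subset is closed, so the only dense subset is the whole space.\<close>

lemma one_separated_has_density_character:
  fixes r :: "'k rel"
  assumes m: "one_separated m" and r: "|mspace m| =o r"
  shows "has_density_character m r"
proof -
  have "mtopology_of m closure_of D = D" if "D \<subseteq> mspace m" for D
    using one_separated_imp_discrete_space[OF m] that
    by (simp add: discrete_space_def discrete_topology_closure_of Int_absorb1)
  then have "dense_subset m D \<longleftrightarrow> D = mspace m" for D
    by (auto simp: dense_subset_def)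
  then show ?thesis
    using r ordIso_imp_ordLeq[OF ordIso_symmetric[OF r]] by (simp add: has_density_character_def)
qed

section \<open>Isometries, and completions of uniformly discrete spaces\<close>

lemma isometric_sym:
  assumes "isometric m m'"
  shows "isometric m' m"
proof -
  obtain h where h: "bij_betw h (mspace m) (mspace m')"
    "\<And>x y. x \<in> mspace m \<Longrightarrow> y \<in> mspace m \<Longrightarrow> mdist m' (h x) (h y) = mdist m x y"
    using assms by (auto simp: isometric_def)
  define g where "g = inv_into (mspace m) h"
  have g: "bij_betw g (mspace m') (mspace m)"
    unfolding g_def using h(1) by (rule bij_betw_inv_into)
  have "mdist m (g x) (g y) = mdist m' x y" if "x \<in> mspace m'" "y \<in> mspace m'" for x y
    using h(2)[of "g x" "g y"] that bij_betw_apply[OF g] bij_betw_inv_into_right[OF h(1)]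
    by (simp add: g_def)
  then show ?thesis
    using g by (auto simp: isometric_def)
qed

lemma isometric_trans:
  assumes "isometric m m'" "isometric m' m''"
  shows "isometric m m''"
proof -
  obtain g h where "bij_betw g (mspace m) (mspace m')" "bij_betw h (mspace m') (mspace m'')"
    "\<forall>x\<in>mspace m. \<forall>y\<in>mspace m. mdist m' (g x) (g y) = mdist m x y"
    "\<forall>x\<in>mspace m'. \<forall>y\<in>mspace m'. mdist m'' (h x) (h y) = mdist m' x y"
    using assms by (auto simp: isometric_def)
  then show ?thesis
    unfolding isometric_def
    by (intro exI[of _ "h \<circ> g"]) (auto intro: bij_betw_trans simp: bij_betw_apply)
qed

lemma isometric_imp_ordIso:
  assumes "isometric m m'"
  shows "|mspace m| =o |mspace m'|"
  using assms card_of_ordIso by (auto simp: isometric_def)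

lemma isometric_one_separated:
  assumes "isometric m m'" "one_separated m"
  shows "one_separated m'"
proof -
  obtain h where h: "bij_betw h (mspace m) (mspace m')"
    "\<forall>x\<in>mspace m. \<forall>y\<in>mspace m. mdist m' (h x) (h y) = mdist m x y"
    using assms(1) by (auto simp: isometric_def)
  then have im: "mspace m' = h ` mspace m" by (simp add: bij_betw_def)
  show ?thesis
    using h(2) assms(2) unfolding one_separated_def im by fastforce
qed

text \<open>Points embed as classes of constant sequences. This is onto because each Cauchy sequence
  is eventually constant, hence equivalent to a constant one.\<close>

lemma isometric_completion:
  assumes m: "one_separated m"
  shows "isometric m (completion m)"
proof -
  interpret Metric_space "mspace m" "mdist m" by simp
  define \<iota> where "\<iota> x = Cauchy_equiv m `` {\<lambda>n::nat. x}" for x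
  have const: "(\<lambda>n. x) \<in> Cauchy_seqs m" if "x \<in> mspace m" for x
    using that by (simp add: MCauchy_def)
  have \<iota>: "\<iota> x \<in> Cauchy_seqs m // Cauchy_equiv m" if "x \<in> mspace m" for x
    unfolding \<iota>_def using const[OF that] by (rule quotientI)
  have self: "(\<lambda>n. x) \<in> \<iota> x" if "x \<in> mspace m" for x
    unfolding \<iota>_def using equiv_Cauchy const[OF that] by (rule equiv_class_self)
  have dist: "completion_dist m (\<iota> x) (\<iota> y) = mdist m x y"
    if "x \<in> mspace m" "y \<in> mspace m" for x y
    using completion_dist_tendsto[OF \<iota> \<iota> self self, OF that that]
    by (simp add: LIMSEQ_const_iff)
  have inj: "inj_on \<iota> (mspace m)"
    by (rule inj_onI) (metis dist zero)
  have surj: "A \<in> \<iota> ` mspace m" if A: "A \<in> Cauchy_seqs m // Cauchy_equiv m" for A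
  proof -
    obtain \<sigma> where \<sigma>: "\<sigma> \<in> Cauchy_seqs m" "A = Cauchy_equiv m `` {\<sigma>}"
      by (rule quotientE[OF A]) blast
    then obtain x where x: "x \<in> mspace m" "\<forall>\<^sub>F n in sequentially. \<sigma> n = x"
      using one_separated_MCauchy[OF m] by blast
    have "(\<lambda>n. mdist m (\<sigma> n) x) \<longlonglongrightarrow> 0"
      using x by (intro tendsto_eventually) (auto elim: eventually_mono)
    then have "(\<sigma>, \<lambda>n. x) \<in> Cauchy_equiv m"
      using \<sigma> const[OF x(1)] by (simp add: Cauchy_equiv_def)
    then have "A = \<iota> x"
      unfolding \<sigma>(2) \<iota>_def by (rule equiv_class_eq[OF equiv_Cauchy])
    then show ?thesis using x by blast
  qed
  have "bij_betw \<iota> (mspace m) (Cauchy_seqs m // Cauchy_equiv m)"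
    unfolding bij_betw_def using inj \<iota> surj by blast
  then show ?thesis
    unfolding isometric_def mspace_completion mdist_completion using dist by blast
qed

section \<open>Codes of uniformly discrete metrics\<close>

text \<open>The restriction to \<open>MS_index\<close> makes the code extensional, as elements of
  \<open>cantor_space\<close> have to be.\<close>

definition metric_code :: "('k \<Rightarrow> 'k \<Rightarrow> real) \<Rightarrow> 'k \<times> 'k \<times> rat \<Rightarrow> bool" where
  "metric_code d = restrict (\<lambda>(x, y, q). d x y \<le> real_of_rat q) MS_index"

lemma metric_code_iff: "0 < q \<Longrightarrow> metric_code d (x, y, q) \<longleftrightarrow> d x y \<le> real_of_rat q"
  by (simp add: metric_code_def MS_index_def)

lemma metric_code_in_cantor_space: "metric_code d \<in> cantor_space MS_index"
  by (simp add: metric_code_def cantor_space_def)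

lemma metric_code_in_MS:
  assumes d: "Metric_space UNIV d" and sep: "\<And>x y. x \<noteq> y \<Longrightarrow> 1 \<le> d x y"
  shows "metric_code d \<in> MS r"
proof -
  interpret Metric_space UNIV d by (rule d)
  have half: "\<not> metric_code d (x, y, 1/2)" if "x \<noteq> y" for x y
    using sep[OF that] by (simp add: metric_code_iff of_rat_divide)
  have upper: "\<exists>q>0. metric_code d (x, y, q)" for x y
  proof -
    obtain q where "d x y < real_of_rat q"
      using of_rat_dense[of "d x y" "d x y + 1"] by auto
    moreover from this have "0 < real_of_rat q"
      using nonneg[of x y] by linarith
    ultimately show ?thesis by (intro exI[of _ q]) (simp add: metric_code_iff)
  qed
  have tri: "metric_code d (x, z, q + q')"
    if "0 < q" "0 < q'" "metric_code d (x, y, q)" "metric_code d (y, z, q')" for x y z q q'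
    using that triangle[of x y z] by (simp add: metric_code_iff of_rat_add)
  have mono: "metric_code d (x, y, q')" if "0 < q" "q \<le> q'" "metric_code d (x, y, q)" for x y q q'
  proof -
    have "real_of_rat q \<le> real_of_rat q'" using that by (simp add: of_rat_less_eq)
    then show ?thesis using that by (simp add: metric_code_iff)
  qed
  \<comment> \<open>The witness for the density condition is \<alpha> itself: it is at distance at
    least 1 from every earlier point, so 1/2 lies below all these distances.\<close>
  have far: "\<exists>\<beta>. \<exists>q>0. \<forall>\<gamma>\<in>underS r \<alpha>. \<not> metric_code d (\<gamma>, \<beta>, q)" for \<alpha>
    using half by (intro exI[of _ \<alpha>] exI[of _ "1/2"]) (auto simp: underS_def)
  have "\<exists>q>0. \<not> metric_code d (\<alpha>, \<beta>, q)" if "\<alpha> \<in> underS r \<beta>" for \<alpha> \<beta>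
    using half[of \<alpha> \<beta>] that by (intro exI[of _ "1/2"]) (auto simp: underS_def)
  then show ?thesis
    unfolding MS_def using metric_code_in_cantor_space upper tri mono far
    by (auto simp: metric_code_iff commute)
qed

text \<open>A real number is the infimum of the rationals strictly above it; these are positive
  because \<open>d\<close> is nonnegative.\<close>

lemma code_dist_metric_code:
  assumes "\<And>x y. 0 \<le> d x y"
  shows "code_dist (metric_code d) = d"
proof (intro ext)
  fix x y
  have S: "{real_of_rat q | q. 0 < q \<and> metric_code d (x, y, q)} =
      {real_of_rat q | q. 0 < q \<and> d x y \<le> real_of_rat q}"
    by (rule Collect_cong) (metis metric_code_iff)
  show "code_dist (metric_code d) x y = d x y"
    unfolding code_dist_def S
  proof (rule cInf_eq)
    fix b assume b: "\<And>s. s \<in> {real_of_rat q | q. 0 < q \<and> d x y \<le> real_of_rat q} \<Longrightarrow> b \<le> s"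
    show "b \<le> d x y"
    proof (rule dense_ge)
      fix t assume "d x y < t"
      then obtain q where q: "d x y < real_of_rat q" "real_of_rat q < t"
        using of_rat_dense by blast
      moreover have "0 < real_of_rat q" using q(1) assms[of x y] by linarith
      ultimately have "b \<le> real_of_rat q" using b by auto
      then show "b \<le> t" using q by linarith
    qed
  qed auto
qed

lemma isometric_code_space:
  assumes d: "Metric_space UNIV d" and sep: "\<And>x y. x \<noteq> y \<Longrightarrow> 1 \<le> d x y"
  shows "one_separated (code_space (metric_code d))"
    and "isometric (metric (UNIV, d)) (code_space (metric_code d))"
proof -
  interpret Metric_space UNIV d by (rule d)
  have "one_separated (metric (UNIV, d))"
    using sep by (simp add: one_separated_def mspace_metric mdist_metric)
  then show "isometric (metric (UNIV, d)) (code_space (metric_code d))"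
    "one_separated (code_space (metric_code d))"
    using isometric_completion isometric_one_separated
    by (auto simp: code_space_def code_dist_metric_code[OF nonneg])
qed

section \<open>The metric of a graph\<close>

text \<open>Both 1 and 3/2 are below 2, so which points are near each other does not depend on
  \<open>G\<close>. The value \<open>G (b, c)\<close> enters only through the distances of the point
  \<open>Inr (b, c)\<close>.\<close>

fun graph_dist :: "('v \<times> 'v \<Rightarrow> bool) \<Rightarrow> 'v + 'v \<times> 'v \<Rightarrow> 'v + 'v \<times> 'v \<Rightarrow> real" where
  "graph_dist G (Inl a) (Inl b) = (if a = b then 0 else 2)"
| "graph_dist G (Inl a) (Inr (b, c)) = (if a = b \<or> a = c then if G (b, c) then 1 else 3/2 else 2)"
| "graph_dist G (Inr (b, c)) (Inl a) = (if a = b \<or> a = c then if G (b, c) then 1 else 3/2 else 2)"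
| "graph_dist G (Inr p) (Inr p') = (if p = p' then 0 else 2)"

lemma graph_dist_commute: "graph_dist G x y = graph_dist G y x"
  by (cases "(G, x, y)" rule: graph_dist.cases) auto

lemma graph_dist_self: "graph_dist G x x = 0"
  by (cases x) auto

lemma graph_dist_bounds:
  assumes "x \<noteq> y"
  shows "1 \<le> graph_dist G x y" "graph_dist G x y \<le> 2"
  using assms by (cases "(G, x, y)" rule: graph_dist.cases; auto)+

text \<open>This locality is what the continuity of the reduction rests on: a distance consults
  \<open>G\<close> only at those of its two points that are pairs.\<close>

lemma graph_dist_cong:
  assumes "\<And>p. Inr p \<in> {x, y} \<Longrightarrow> G p = H p"
  shows "graph_dist G x y = graph_dist H x y"
  using assms by (cases "(G, x, y)" rule: graph_dist.cases) auto

text \<open>Distances between distinct points lie between 1 and 2, and 2 is at most 1 + 1, so the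
  triangle inequality is automatic.\<close>

lemma Metric_space_graph_dist: "Metric_space UNIV (graph_dist G)"
proof
  fix x y z
  show "0 \<le> graph_dist G x y"
    using graph_dist_bounds(1)[of x y G] graph_dist_self[of G x] by (cases "x = y") auto
  show "graph_dist G x y = graph_dist G y x" by (rule graph_dist_commute)
  show "graph_dist G x y = 0 \<longleftrightarrow> x = y"
    using graph_dist_bounds(1)[of x y G] graph_dist_self[of G x] by (cases "x = y") auto
  show "graph_dist G x z \<le> graph_dist G x y + graph_dist G y z"
    using graph_dist_bounds[of x y G] graph_dist_bounds[of y z G] graph_dist_bounds[of x z G]
      graph_dist_self[of G x] graph_dist_self[of G z]
    by (cases "x = y"; cases "y = z"; cases "x = z") (auto simp: graph_dist_commute)
qed

text \<open>All pairs with first coordinate a are near a, whether or not they are edges. With the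
  next lemma this separates vertices from pairs in purely metric terms.\<close>

lemma infinite_near_vertex:
  assumes "infinite (UNIV :: 'v set)"
  shows "infinite {x. graph_dist G (Inl (a :: 'v)) x < 2}"
proof -
  have "range (\<lambda>b. Inr (a, b)) \<subseteq> {x. graph_dist G (Inl a) x < 2}" by auto
  moreover have "infinite (range (\<lambda>b. Inr (a, b) :: 'v + 'v \<times> 'v))"
    using assms by (simp add: finite_image_iff inj_def)
  ultimately show ?thesis using finite_subset by blast
qed

lemma finite_near_pair: "finite {x. graph_dist G (Inr p) x < 2}"
proof -
  have "x \<in> {Inr p, Inl (fst p), Inl (snd p)}" if "graph_dist G (Inr p) x < 2" for x
    using that by (cases p; cases x) (auto split: if_splits)
  then have "{x. graph_dist G (Inr p) x < 2} \<subseteq> {Inr p, Inl (fst p), Inl (snd p)}" by blast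
  then show ?thesis by (rule finite_subset) simp
qed

text \<open>Vertices are at distance 0 or 2 from each other, so a common point at distance 1 is a
  pair. For distinct a and b it must be (a, b) or (b, a), and \<open>G\<close> is symmetric. If a =
  b were allowed, any neighbour of a would provide a witness.\<close>

lemma edge_iff_common_near:
  assumes "G \<in> GRAPHS"
  shows "G (a, b) \<longleftrightarrow> a \<noteq> b \<and> (\<exists>x. graph_dist G (Inl a) x = 1 \<and> graph_dist G (Inl b) x = 1)"
proof
  assume "G (a, b)"
  then show "a \<noteq> b \<and> (\<exists>x. graph_dist G (Inl a) x = 1 \<and> graph_dist G (Inl b) x = 1)"
    using assms by (intro conjI exI[of _ "Inr (a, b)"]) (auto simp: GRAPHS_def)
next
  assume "a \<noteq> b \<and> (\<exists>x. graph_dist G (Inl a) x = 1 \<and> graph_dist G (Inl b) x = 1)"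
  then obtain x where x: "a \<noteq> b" "graph_dist G (Inl a) x = 1" "graph_dist G (Inl b) x = 1" by blast
  then obtain c d where "x = Inr (c, d)" by (cases x) (auto split: if_splits)
  with x have "G (c, d)" "(c, d) = (a, b) \<or> (c, d) = (b, a)" by (auto split: if_splits)
  then show "G (a, b)" using assms by (auto simp: GRAPHS_def)
qed

text \<open>A graph isomorphism acts on vertices and coordinatewise on pairs. Conversely, being a
  vertex and being adjacent are metric notions, so an isometry restricts to a graph isomorphism on
  vertices. It may send the point of (a, b) to that of (\<pi> b, \<pi> a), so adjacency is read off
  through \<open>edge_iff_common_near\<close> rather than from the image of a given pair.\<close>

lemma graph_iso_iff_graph_dist:
  fixes G H :: "'v \<times> 'v \<Rightarrow> bool"
  assumes inf: "infinite (UNIV :: 'v set)" and G: "G \<in> GRAPHS" and H: "H \<in> GRAPHS"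
  shows "graph_iso G H \<longleftrightarrow>
    (\<exists>s. bij s \<and> (\<forall>x y. graph_dist H (s x) (s y) = graph_dist G x y))"
proof
  assume "graph_iso G H"
  then obtain \<pi> where \<pi>: "bij \<pi>" "\<And>a b. G (a, b) \<longleftrightarrow> H (\<pi> a, \<pi> b)"
    by (auto simp: graph_iso_def)
  define s where "s = map_sum \<pi> (map_prod \<pi> \<pi>)"
  have eq: "\<pi> a = \<pi> b \<longleftrightarrow> a = b" for a b using \<pi>(1) by (meson bij_is_inj inj_eq)
  have "bij s"
  proof (rule o_bij)
    have inv: "inv \<pi> (\<pi> a) = a" "\<pi> (inv \<pi> a) = a" for a
      using \<pi>(1) by (simp_all add: bij_is_inj bij_is_surj surj_f_inv_f)
    show "map_sum (inv \<pi>) (map_prod (inv \<pi>) (inv \<pi>)) \<circ> s = id"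
    proof
      fix x show "(map_sum (inv \<pi>) (map_prod (inv \<pi>) (inv \<pi>)) \<circ> s) x = id x"
        by (cases x) (auto simp: s_def inv)
    qed
    show "s \<circ> map_sum (inv \<pi>) (map_prod (inv \<pi>) (inv \<pi>)) = id"
    proof
      fix x show "(s \<circ> map_sum (inv \<pi>) (map_prod (inv \<pi>) (inv \<pi>))) x = id x"
        by (cases x) (auto simp: s_def inv)
    qed
  qed
  moreover have "graph_dist H (s x) (s y) = graph_dist G x y" for x y
    by (cases "(G, x, y)" rule: graph_dist.cases) (auto simp: s_def eq \<pi>(2))
  ultimately show "\<exists>s. bij s \<and> (\<forall>x y. graph_dist H (s x) (s y) = graph_dist G x y)" by blast
next
  assume "\<exists>s. bij s \<and> (\<forall>x y. graph_dist H (s x) (s y) = graph_dist G x y)"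
  then obtain s where s: "bij s" "\<And>x y. graph_dist H (s x) (s y) = graph_dist G x y" by blast
  have near: "{y. graph_dist H (s x) y < 2} = s ` {y. graph_dist G x y < 2}" for x
  proof -
    have "y \<in> s ` {y. graph_dist G x y < 2}" if "graph_dist H (s x) y < 2" for y
      using that s by (metis (mono_tags, lifting) bij_pointE imageI mem_Collect_eq)
    then show ?thesis using s(2) by auto
  qed
  have "infinite {y. graph_dist H (s x) y < 2} \<longleftrightarrow> infinite {y. graph_dist G x y < 2}" for x
    unfolding near using s(1) by (metis bij_is_inj finite_image_iff inj_on_subset subset_UNIV)
  \<comment> \<open>The criterion is the same for \<open>G\<close> and \<open>H\<close>, so s maps
    vertices to vertices and pairs to pairs; the second half gives surjectivity of \<pi>
    below.\<close>
  moreover have vertex: "infinite {y. graph_dist K x y < 2} \<longleftrightarrow> x \<in> range Inl"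
    for K :: "'v \<times> 'v \<Rightarrow> bool" and x
    by (cases x) (simp_all add: infinite_near_vertex[OF inf] finite_near_pair image_iff)
  ultimately have range: "s x \<in> range Inl \<longleftrightarrow> x \<in> range Inl" for x by metis
  then have "\<forall>a. \<exists>b. s (Inl a) = Inl b" by blast
  then obtain \<pi> where \<pi>: "\<And>a. s (Inl a) = Inl (\<pi> a)" by metis
  have "bij \<pi>"
  proof (rule bijI)
    show "inj \<pi>" using \<pi> s(1) by (metis Inl_inject bij_is_inj injD injI)
    show "surj \<pi>"
      unfolding surj_def
    proof
      fix b
      obtain x where x: "Inl b = s x" using s(1) by (metis bij_pointE)
      then have "x \<in> range Inl" using range[of x] by (metis rangeI)
      then obtain a where "x = Inl a" by blast
      with x \<pi> show "\<exists>a. b = \<pi> a" by auto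
    qed
  qed
  moreover have "G (a, b) \<longleftrightarrow> H (\<pi> a, \<pi> b)" for a b
  proof -
    \<comment> \<open>Surjectivity of s turns a common near point in the space of \<open>H\<close>
      back into one in the space of \<open>G\<close>.\<close>
    have "(\<exists>x. graph_dist G (Inl a) x = 1 \<and> graph_dist G (Inl b) x = 1) \<longleftrightarrow>
      (\<exists>x. graph_dist H (Inl (\<pi> a)) x = 1 \<and> graph_dist H (Inl (\<pi> b)) x = 1)"
      using s \<pi> by (metis bij_pointE)
    moreover have "\<pi> a = \<pi> b \<longleftrightarrow> a = b" using \<open>bij \<pi>\<close> by (meson bij_is_inj inj_eq)
    ultimately show ?thesis
      unfolding edge_iff_common_near[OF G] edge_iff_common_near[OF H] by simp
  qed
  ultimately show "graph_iso G H" by (auto simp: graph_iso_def)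
qed

section \<open>Placing the points\<close>

text \<open>Transfinite recursion: at \<delta> the forbidden values are \<open>W \<delta>\<close>
  and the values chosen earlier. Both sets are smaller than the infinite cardinal \<kappa>, hence so
  is their union, and some value remains. Avoiding earlier values gives injectivity.\<close>

lemma inj_avoiding_small_sets:
  fixes r :: "'k rel"
  assumes r: "card_order r" and inf: "infinite (UNIV :: 'k set)"
    and W: "\<And>\<delta>. |W \<delta>| <o r"
  obtains h :: "'k \<Rightarrow> 'k" where "inj h" "\<And>\<delta>. h \<delta> \<notin> W \<delta>"
proof -
  have co: "Card_order r" "Field r = UNIV" using r card_order_on_Card_order by blast+
  have wo: "well_order_on UNIV r" using r by (simp add: card_order_on_def)
  have wf: "wf (r - Id)" using wo by (simp add: well_order_on_def)
  have "\<exists>h. \<forall>\<delta>. h \<delta> \<notin> W \<delta> \<union> h ` underS r \<delta>"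
  proof (rule dependent_wf_choice[OF wf])
    \<comment> \<open>The forbidden set depends on the function only through its values below
      \<delta>, as the recursion requires.\<close>
    fix f g :: "'k \<Rightarrow> 'k" and \<delta> x
    assume "\<And>z. (z, \<delta>) \<in> r - Id \<Longrightarrow> f z = g z"
    then have "f ` underS r \<delta> = g ` underS r \<delta>"
      by (intro image_cong) (auto simp: underS_def)
    then show "(x \<notin> W \<delta> \<union> f ` underS r \<delta>) = (x \<notin> W \<delta> \<union> g ` underS r \<delta>)" by simp
  next
    fix \<delta> and f :: "'k \<Rightarrow> 'k"
    have "|f ` underS r \<delta>| <o r"
      using card_of_image card_of_underS[OF co(1)] co(2) ordLeq_ordLess_trans by blast
    then have "|W \<delta> \<union> f ` underS r \<delta>| <o r"
      using co inf W by (intro card_of_Un_ordLess_infinite_Field) auto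
    then have "W \<delta> \<union> f ` underS r \<delta> \<noteq> UNIV"
      using card_of_unique[OF r] by (metis not_ordLess_ordIso ordIso_symmetric)
    then show "\<exists>x. x \<notin> W \<delta> \<union> f ` underS r \<delta>" by blast
  qed
  then obtain h where h: "\<And>\<delta>. h \<delta> \<notin> W \<delta>" "\<And>\<delta>. h \<delta> \<notin> h ` underS r \<delta>" by blast
  have "inj h"
  proof (rule injI, rule ccontr)
    fix x y assume "h x = h y" "x \<noteq> y"
    moreover have "x \<in> underS r y \<or> y \<in> underS r x"
      using wo \<open>x \<noteq> y\<close> by (auto simp: well_order_on_def linear_order_on_def total_on_def underS_def)
    ultimately show False using h(2) by (metis imageI)
  qed
  then show ?thesis using that h(1) by blast
qed

text \<open>The pairs have to avoid \<open>W\<close> and also leave \<kappa> many places for the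
  vertices. The previous lemma is applied to a family in which each set \<open>W \<epsilon>\<close>
  recurs once for every second coordinate: the coordinate a serves the pairs, and the values at the
  coordinate b stay free.\<close>

lemma point_placement:
  fixes r :: "'k rel" and e :: "'k \<times> 'k \<Rightarrow> 'k"
  assumes r: "card_order r" and inf: "infinite (UNIV :: 'k set)" and e: "bij e"
    and W: "\<And>\<delta>. |W \<delta>| <o r"
  shows "\<exists>P :: 'k + 'k \<times> 'k \<Rightarrow> 'k. bij P \<and> (\<forall>p. P (Inr p) \<notin> W (e p))"
proof -
  obtain h where h: "inj h" "\<And>\<delta>. h \<delta> \<notin> W (fst (inv e \<delta>))"
    using inj_avoiding_small_sets[OF r inf, of "\<lambda>\<delta>. W (fst (inv e \<delta>))"] W by blast
  obtain a b :: 'k where ab: "a \<noteq> b"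
    using inf by (metis (full_types) UNIV_eq_I finite.simps insertI1)
  define g where "g p = h (e (e p, a))" for p
  have eq: "h (e p) = h (e p') \<longleftrightarrow> p = p'" "e p = e p' \<longleftrightarrow> p = p'" for p p'
    using h(1) e by (metis bij_is_inj inj_eq)+
  have g: "inj g" by (auto simp: inj_def g_def eq)
  \<comment> \<open>The values of h at indices with second coordinate b lie outside
    \<open>range g\<close>, so the complement has size \<kappa> and the vertices can fill it
    exactly.\<close>
  have "\<exists>v. bij_betw v (UNIV :: 'k set) (- range g)"
  proof (rule Schroeder_Bernstein)
    show "inj (\<lambda>x. h (e (x, b)))" by (auto simp: inj_def eq)
    show "range (\<lambda>x. h (e (x, b))) \<subseteq> - range g" using ab by (auto simp: g_def eq)
    show "inj_on id (- range g)" by simp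
  qed simp
  then obtain v where v: "bij_betw v (UNIV :: 'k set) (- range g)" by blast
  show ?thesis
  proof (intro exI[of _ "case_sum v g"] conjI allI)
    show "bij (case_sum v g)"
    proof (rule bijI)
      show "inj (case_sum v g)"
      proof (rule injI)
        fix x y assume xy: "case_sum v g x = case_sum v g y"
        have "v a \<noteq> g p" for a p using v by (auto simp: bij_betw_def)
        then show "x = y"
          using xy g v by (cases x; cases y) (metis bij_betw_imp_inj_on injD old.sum.simps(5,6))+
      qed
      show "surj (case_sum v g)"
        unfolding surj_def
      proof
        fix y
        show "\<exists>x. y = case_sum v g x"
        proof (cases "y \<in> range g")
          case True
          then obtain p where "y = g p" by blast
          then show ?thesis by (intro exI[of _ "Inr p"]) simp
        next
          case False
          then have "y \<in> range v" using v by (simp add: bij_betw_def)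
          then obtain x where "y = v x" by blast
          then show ?thesis by (intro exI[of _ "Inl x"]) simp
        qed
      qed
    qed
    fix p
    show "case_sum v g (Inr p) \<notin> W (e p)"
      using h(2)[of "e (e p, a)"] e by (simp add: g_def bij_is_inj)
  qed
qed

section \<open>The reduction\<close>

theorem theorem4p9:
  fixes r :: "'k rel"
    and e\<^sub>2 :: "'k \<times> 'k \<Rightarrow> 'k"
    and e\<^sub>3 :: "'k \<times> 'k \<times> rat \<Rightarrow> 'k"
  assumes "card_order r"
    and "uncountable (UNIV :: 'k set)"
    and "bij_betw e\<^sub>2 UNIV UNIV"
    and "bij_betw e\<^sub>3 MS_index UNIV"
  shows "\<exists>f. kborel_fun r (cantor_topology r UNIV e\<^sub>2) GRAPHS (cantor_topology r MS_index e\<^sub>3) (MS r) f \<and>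
    (\<forall>G\<in>GRAPHS. \<forall>H\<in>GRAPHS. graph_iso G H \<longleftrightarrow> isometric (code_space (f G)) (code_space (f H))) \<and>
    (\<forall>G\<in>GRAPHS. discrete_space (code_space (f G))) \<and>
    (\<forall>G\<in>GRAPHS. mcomplete_of (code_space (f G)) \<and> has_density_character (code_space (f G)) r)"
proof -
  note r = assms(1)
  have co: "Card_order r" "Field r = UNIV" using r card_order_on_Card_order by blast+
  have wo: "Well_order r" using co(1) by (rule card_order_on_well_order_on)
  have "refl_on UNIV r" "total_on UNIV r"
    using wo co(2) by (simp_all add: order_on_defs)
  then have total: "(\<gamma>, \<delta>) \<in> r \<or> \<delta> \<in> underS r \<gamma>" for \<gamma> \<delta>
    unfolding refl_on_def total_on_def underS_def by (cases "\<gamma> = \<delta>") auto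
  have inf: "infinite (UNIV :: 'k set)" using assms(2) countable_finite by blast
  \<comment> \<open>\<open>W \<delta>\<close> collects the points mentioned by code coordinates
    placed before \<delta>. Keeping the point of a pair p out of \<open>W (e\<^sub>2 p)\<close>
    means that no code coordinate before \<open>e\<^sub>2 p\<close> mentions it.\<close>
  define W where "W \<delta> = fst ` inv_into MS_index e\<^sub>3 ` underS r \<delta> \<union>
    (fst \<circ> snd) ` inv_into MS_index e\<^sub>3 ` underS r \<delta>" for \<delta>
  have small: "|g ` underS r \<delta>| <o r" for g :: "'k \<Rightarrow> 'k" and \<delta>
    using card_of_image card_of_underS[OF co(1)] co(2) ordLeq_ordLess_trans by blast
  have W: "|W \<delta>| <o r" for \<delta>
    unfolding W_def image_image
    using co inf small by (intro card_of_Un_ordLess_infinite_Field) auto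
  obtain P :: "'k + 'k \<times> 'k \<Rightarrow> 'k" where P: "bij P" "\<And>p. P (Inr p) \<notin> W (e\<^sub>2 p)"
    using point_placement[where W = W, OF r inf assms(3) W] by blast
  define d where "d G x y = graph_dist G (inv P x) (inv P y)" for G x y
  have invP: "inv P x = inv P y \<longleftrightarrow> x = y" for x y
    using P(1) by (metis bij_inv_eq_iff)
  have metric: "Metric_space UNIV (d G)" for G
  proof -
    interpret g: Metric_space UNIV "graph_dist G" by (rule Metric_space_graph_dist)
    show ?thesis
      by unfold_locales (simp_all add: d_def g.commute g.triangle invP)
  qed
  have sep: "1 \<le> d G x y" if "x \<noteq> y" for G x y
    unfolding d_def using that invP by (intro graph_dist_bounds) simp
  define f where "f G = metric_code (d G)" for G

  have loc: "f G j = f H j"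
    if agree: "\<And>p. p \<in> UNIV \<Longrightarrow> e\<^sub>2 p \<in> underS r \<gamma> \<Longrightarrow> G p = H p"
      and j: "j \<in> MS_index" "e\<^sub>3 j \<in> underS r \<gamma>" for \<gamma> G H j
  proof -
    obtain x y q where jq: "j = (x, y, q)" by (cases j)
    have "inv_into MS_index e\<^sub>3 (e\<^sub>3 j) = j"
      using assms(4) j(1) by (rule bij_betw_inv_into_left)
    then have xy: "x \<in> W \<gamma>" "y \<in> W \<gamma>"
      using j(2) jq unfolding W_def by (force simp: image_iff)+
    have "d G x y = d H x y"
      unfolding d_def
    proof (rule graph_dist_cong)
      fix p assume "Inr p \<in> {inv P x, inv P y}"
      then have "P (Inr p) \<in> {x, y}" using P(1) by (metis bij_inv_eq_iff insert_iff singletonD)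
      then have "P (Inr p) \<in> W \<gamma>" using xy by blast
      \<comment> \<open>\<open>W\<close> grows with its index. The place of p lies in
        \<open>W \<gamma>\<close> but not in \<open>W (e\<^sub>2 p)\<close>, so
        \<open>e\<^sub>2 p\<close> is strictly below \<gamma>, where \<open>G\<close> and
        \<open>H\<close> agree.\<close>
      then have "\<not> underS r \<gamma> \<subseteq> underS r (e\<^sub>2 p)" using P(2)[of p] unfolding W_def by blast
      then have "(\<gamma>, e\<^sub>2 p) \<notin> r"
        using underS_incr[of r \<gamma> "e\<^sub>2 p"] wo
        by (auto simp: well_order_on_def linear_order_on_def partial_order_on_def preorder_on_def)
      then have "e\<^sub>2 p \<in> underS r \<gamma>"
        using total[of \<gamma> "e\<^sub>2 p"] by blast
      then show "G p = H p" using agree by simp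
    qed
    then show ?thesis using j(1) by (simp add: f_def metric_code_def jq)
  qed
  have "continuous_map (cantor_topology r UNIV e\<^sub>2) (cantor_topology r MS_index e\<^sub>3) f"
  proof (rule continuous_map_cantor_topology[OF r assms(3,4)])
    show "f \<in> cantor_space UNIV \<rightarrow> cantor_space MS_index"
      by (simp add: f_def metric_code_in_cantor_space)
  qed (rule loc)
  moreover have "f \<in> GRAPHS \<rightarrow> MS r"
    unfolding f_def by (intro Pi_I metric_code_in_MS metric sep)
  moreover have "GRAPHS \<subseteq> topspace (cantor_topology r UNIV e\<^sub>2)"
    by (simp add: topspace_cantor_topology[OF r] cantor_space_def)
  moreover have "MS r \<subseteq> topspace (cantor_topology r MS_index e\<^sub>3)"
    unfolding topspace_cantor_topology[OF r] MS_def by blast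
  ultimately have "kborel_fun r (cantor_topology r UNIV e\<^sub>2) GRAPHS
      (cantor_topology r MS_index e\<^sub>3) (MS r) f"
    by (intro continuous_map_imp_kborel_fun)
  moreover have "graph_iso G H \<longleftrightarrow> isometric (code_space (f G)) (code_space (f H))"
    if G: "G \<in> GRAPHS" and H: "H \<in> GRAPHS" for G H
  proof -
    note iso = isometric_code_space(2)[OF metric sep]
    have "isometric (code_space (f G)) (code_space (f H)) \<longleftrightarrow>
        isometric (metric (UNIV, d G)) (metric (UNIV, d H))"
      unfolding f_def using iso isometric_sym isometric_trans by metis
    also have "\<dots> \<longleftrightarrow> (\<exists>t. bij t \<and> (\<forall>x y. d H (t x) (t y) = d G x y))"
      by (simp add: isometric_def Metric_space.mspace_metric[OF metric]
          Metric_space.mdist_metric[OF metric])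
    \<comment> \<open>Conjugation by \<open>P\<close> translates between isometries on \<kappa> and
      isometries of the graph metrics.\<close>
    also have "\<dots> \<longleftrightarrow> (\<exists>s. bij s \<and> (\<forall>x y. graph_dist H (s x) (s y) = graph_dist G x y))"
    proof
      assume "\<exists>t. bij t \<and> (\<forall>x y. d H (t x) (t y) = d G x y)"
      then obtain t where t: "bij t" "\<And>x y. d H (t x) (t y) = d G x y" by blast
      have "bij (inv P \<circ> t \<circ> P)"
        using t(1) P(1) by (intro bij_comp bij_imp_bij_inv)
      moreover have "graph_dist H ((inv P \<circ> t \<circ> P) x) ((inv P \<circ> t \<circ> P) y) = graph_dist G x y" for x y
        using t(2)[of "P x" "P y"] P(1) by (simp add: d_def bij_is_inj)
      ultimately show "\<exists>s. bij s \<and> (\<forall>x y. graph_dist H (s x) (s y) = graph_dist G x y)" by blast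
    next
      assume "\<exists>s. bij s \<and> (\<forall>x y. graph_dist H (s x) (s y) = graph_dist G x y)"
      then obtain s where s: "bij s" "\<And>x y. graph_dist H (s x) (s y) = graph_dist G x y" by blast
      have "bij (P \<circ> s \<circ> inv P)"
        using s(1) P(1) by (intro bij_comp bij_imp_bij_inv)
      moreover have "d H ((P \<circ> s \<circ> inv P) x) ((P \<circ> s \<circ> inv P) y) = d G x y" for x y
        using s(2) P(1) by (simp add: d_def bij_is_inj)
      ultimately show "\<exists>t. bij t \<and> (\<forall>x y. d H (t x) (t y) = d G x y)" by blast
    qed
    also have "\<dots> \<longleftrightarrow> graph_iso G H"
      by (rule graph_iso_iff_graph_dist[OF inf G H, symmetric])
    finally show ?thesis ..
  qed
  moreover have "one_separated (code_space (f G))" for G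
    unfolding f_def by (rule isometric_code_space(1)[OF metric sep])
  moreover have "|mspace (code_space (f G))| =o r" for G
  proof -
    have "|UNIV :: 'k set| =o |mspace (code_space (f G))|"
      using isometric_imp_ordIso[OF isometric_code_space(2)[OF metric sep]]
      by (simp add: f_def Metric_space.mspace_metric[OF metric])
    then show ?thesis
      using card_of_unique[OF r] ordIso_symmetric ordIso_transitive by blast
  qed
  ultimately show ?thesis
    by (intro exI[of _ f] conjI ballI)
      (simp_all add: one_separated_imp_discrete_space one_separated_imp_mcomplete_of
        one_separated_has_density_character)
qed

end
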